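(* Let $r$ be an odd positive integer and let $G$ be an $r$-regular, nonbipartite, connected graph. Then $G$ contains a good even tree, i.e., a subgraph $T$ of $G$ that is an even tree such that the graph $G \setminus V(T)$ (obtained by deleting the vertices of $T$) has a good $\{1,2\}$-factor.
   Context: All graphs are finite and contain no loops. A tree is called even if every pair of its vertices of degree one (leaves) is joined in the tree by a path of even length. A spanning subgraph $F$ of a graph $H$ (i.e., $V(F)=V(H)$) is a $\{1,2\}$-factor of $H$ if $1 \le d_F(x) \le 2$ for all $x \in V(H)$; it is good if each of its components is regular (so each component is a single edge or a cycle). An even tree $T$ in $G$ is good if $G \setminus V(T)$ has a good $\{1,2\}$-factor (this holds vacuously if $V(T)=V(G)$). *)

theory Defs
  imports Main
begin

text \<open>
  Finite loopless graphs, with parallel edges allowed: edges are named objects, and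
  \<open>ends\<close> sends each edge to its set of two end vertices.
\<close>

record ('v, 'e) multigraph =
  verts :: "'v set"
  edges :: "'e set"
  ends :: "'e \<Rightarrow> 'v set"

definition graph :: "('v, 'e) multigraph \<Rightarrow> bool" where
  "graph G \<longleftrightarrow> finite (verts G) \<and> finite (edges G) \<and>
     (\<forall>e\<in>edges G. ends G e \<subseteq> verts G \<and> card (ends G e) = 2)"

definition degree :: "('v, 'e) multigraph \<Rightarrow> 'v \<Rightarrow> nat" where
  "degree G x = card {e \<in> edges G. x \<in> ends G e}"

definition regular :: "nat \<Rightarrow> ('v, 'e) multigraph \<Rightarrow> bool" where
  "regular r G \<longleftrightarrow> (\<forall>x\<in>verts G. degree G x = r)"

definition bipartite :: "('v, 'e) multigraph \<Rightarrow> bool" where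
  "bipartite G \<longleftrightarrow> (\<exists>A B. A \<union> B = verts G \<and> A \<inter> B = {} \<and>
     (\<forall>e\<in>edges G. \<exists>a\<in>A. \<exists>b\<in>B. ends G e = {a, b}))"

text \<open>
  \<open>walk G xs es\<close>: the walk through the vertices \<open>xs\<close> (never empty) along the edges \<open>es\<close>;
  its length is \<open>length es\<close>.
\<close>

inductive walk :: "('v, 'e) multigraph \<Rightarrow> 'v list \<Rightarrow> 'e list \<Rightarrow> bool" for G where
  walk_single: "x \<in> verts G \<Longrightarrow> walk G [x] []"
| walk_step: "e \<in> edges G \<Longrightarrow> ends G e = {x, y} \<Longrightarrow> x \<in> verts G \<Longrightarrow> walk G (y # xs) es
    \<Longrightarrow> walk G (x # y # xs) (e # es)"

definition path_between :: "('v, 'e) multigraph \<Rightarrow> 'v \<Rightarrow> 'v list \<Rightarrow> 'e list \<Rightarrow> 'v \<Rightarrow> bool" where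
  "path_between G x xs es y \<longleftrightarrow> walk G xs es \<and> distinct xs \<and> hd xs = x \<and> last xs = y"

definition connected_graph :: "('v, 'e) multigraph \<Rightarrow> bool" where
  "connected_graph G \<longleftrightarrow> verts G \<noteq> {} \<and>
     (\<forall>x\<in>verts G. \<forall>y\<in>verts G. \<exists>xs es. path_between G x xs es y)"

text \<open>
  Two parallel edges form a cycle of length 2. Distinctness of the edges rules out
  traversing one edge back and forth.
\<close>

definition cycle :: "('v, 'e) multigraph \<Rightarrow> 'v list \<Rightarrow> 'e list \<Rightarrow> bool" where
  "cycle G xs es \<longleftrightarrow> walk G xs es \<and> es \<noteq> [] \<and> hd xs = last xs \<and> distinct (tl xs) \<and> distinct es"

text \<open>A single vertex is a tree (and has no leaf); the empty graph is not connected.\<close>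

definition tree :: "('v, 'e) multigraph \<Rightarrow> bool" where
  "tree T \<longleftrightarrow> graph T \<and> connected_graph T \<and> \<not> (\<exists>xs es. cycle T xs es)"

definition even_tree :: "('v, 'e) multigraph \<Rightarrow> bool" where
  "even_tree T \<longleftrightarrow> tree T \<and>
     (\<forall>x\<in>verts T. \<forall>y\<in>verts T. degree T x = 1 \<longrightarrow> degree T y = 1 \<longrightarrow>
       (\<exists>xs es. path_between T x xs es y \<and> even (length es)))"

text \<open>
  A subgraph keeps the whole function \<open>ends\<close>, so that it is determined by its vertices
  and edges.
\<close>

definition subgraph :: "('v, 'e) multigraph \<Rightarrow> ('v, 'e) multigraph \<Rightarrow> bool" where
  "subgraph H G \<longleftrightarrow> graph H \<and> verts H \<subseteq> verts G \<and> edges H \<subseteq> edges G \<and> ends H = ends G"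

definition spanning_subgraph :: "('v, 'e) multigraph \<Rightarrow> ('v, 'e) multigraph \<Rightarrow> bool" where
  "spanning_subgraph F H \<longleftrightarrow> subgraph F H \<and> verts F = verts H"

definition component :: "('v, 'e) multigraph \<Rightarrow> ('v, 'e) multigraph \<Rightarrow> bool" where
  "component C G \<longleftrightarrow> subgraph C G \<and> connected_graph C \<and>
     (\<forall>D. subgraph D G \<longrightarrow> connected_graph D \<longrightarrow> subgraph C D \<longrightarrow> D = C)"

definition delete_verts :: "('v, 'e) multigraph \<Rightarrow> 'v set \<Rightarrow> ('v, 'e) multigraph" where
  "delete_verts G S =
     \<lparr>verts = verts G - S, edges = {e \<in> edges G. ends G e \<inter> S = {}}, ends = ends G\<rparr>"

definition one_two_factor :: "('v, 'e) multigraph \<Rightarrow> ('v, 'e) multigraph \<Rightarrow> bool" where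
  "one_two_factor F H \<longleftrightarrow> spanning_subgraph F H \<and>
     (\<forall>x\<in>verts H. 1 \<le> degree F x \<and> degree F x \<le> 2)"

definition good_one_two_factor :: "('v, 'e) multigraph \<Rightarrow> ('v, 'e) multigraph \<Rightarrow> bool" where
  "good_one_two_factor F H \<longleftrightarrow> one_two_factor F H \<and>
     (\<forall>C. component C F \<longrightarrow> (\<exists>k. regular k C))"

definition good_even_tree :: "('v, 'e) multigraph \<Rightarrow> ('v, 'e) multigraph \<Rightarrow> bool" where
  "good_even_tree T G \<longleftrightarrow> subgraph T G \<and> even_tree T \<and>
     (\<exists>F. good_one_two_factor F (delete_verts G (verts T)))"

end

theory Submission imports Defs
begin

text \<open>
  The tree can be a single vertex \<open>v\<close>, chosen arbitrarily. By Hall's theorem there is a permutation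
  \<open>\<sigma>\<close> of the remaining vertices that moves every vertex along an edge: in a regular graph a set \<open>X\<close>
  has at least \<open>card X\<close> neighbours, and if it has exactly \<open>card X\<close> of them then the neighbours of
  the neighbours lie in \<open>X\<close> again, which in a connected nonbipartite graph forces \<open>X\<close> to be empty or
  everything. The edges joining \<open>x\<close> to \<open>\<sigma> x\<close> form the factor; its components are the cycles of \<open>\<sigma>\<close>.
\<close>

section \<open>Hall's marriage theorem\<close>

text \<open>Induction on the number of indices. If some nonempty proper \<open>J\<close> is tight,
  meaning that its union has exactly \<open>card J\<close> elements, then \<open>J\<close> is
  matched inside its union and \<open>I - J\<close> outside it. If no such \<open>J\<close> exists,
  every nonempty proper subfamily has an element to spare, so any value may be given to one index
  and withdrawn from all the others.\<close>

theorem hall_marriage: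
  fixes A :: "'i \<Rightarrow> 'a set"
  assumes "finite I" and "\<And>i. i \<in> I \<Longrightarrow> finite (A i)"
    and "\<And>J. J \<subseteq> I \<Longrightarrow> card J \<le> card (\<Union> (A ` J))"
  shows "\<exists>f. inj_on f I \<and> (\<forall>i\<in>I. f i \<in> A i)"
  using assms
proof (induction "card I" arbitrary: I A rule: less_induct)
  case less
  note fin = less.prems(1,2) and hall = less.prems(3)
  show ?case
  proof (cases "\<exists>J. J \<noteq> {} \<and> J \<subset> I \<and> card (\<Union> (A ` J)) = card J")
    case True
    then obtain J where J: "J \<noteq> {}" "J \<subset> I" "card (\<Union> (A ` J)) = card J" by blast
    let ?U = "\<Union> (A ` J)"
    let ?B = "\<lambda>i. A i - ?U"
    have finJ: "finite J" using J(2) fin(1) by (auto intro: finite_subset)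
    have finU: "finite ?U" using J(2) finJ fin(2) by auto
    have "\<exists>f. inj_on f J \<and> (\<forall>i\<in>J. f i \<in> A i)"
    proof (rule less.hyps)
      show "card J < card I" using J(2) fin(1) by (rule psubset_card_mono[rotated])
      show "card K \<le> card (\<Union> (A ` K))" if "K \<subseteq> J" for K
        using that J(2) by (intro hall) auto
      show "finite (A i)" if "i \<in> J" for i using that J(2) fin(2) by auto
    qed (rule finJ)
    then obtain f where f: "inj_on f J" "\<forall>i\<in>J. f i \<in> A i" by blast
    have "\<exists>g. inj_on g (I - J) \<and> (\<forall>i\<in>I - J. g i \<in> ?B i)"
    proof (rule less.hyps)
      show "card (I - J) < card I"
        using J fin(1) by (intro psubset_card_mono) auto
      show "card K \<le> card (\<Union> (?B ` K))" if "K \<subseteq> I - J" for K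
      proof -
        have finK: "finite K" using that fin(1) by (auto intro: finite_subset)
        have finBK: "finite (\<Union> (?B ` K))" using that finK fin(2) by auto
        \<comment> \<open>Hall's condition survives removing \<open>?U\<close>: apply it to
          \<open>K \<union> J\<close> and cancel \<open>card ?U\<close> against
          \<open>card J\<close>, which is possible because \<open>J\<close> is tight.\<close>
        have "card K + card J = card (K \<union> J)"
          using that finK finJ by (subst card_Un_disjoint) auto
        also have "\<dots> \<le> card (\<Union> (A ` (K \<union> J)))"
          using that J(2) by (intro hall) auto
        also have "\<Union> (A ` (K \<union> J)) = \<Union> (?B ` K) \<union> ?U" by auto
        also have "card \<dots> = card (\<Union> (?B ` K)) + card ?U"
          using finBK finU by (intro card_Un_disjoint) auto
        finally show ?thesis using J(3) by simp
      qed
    qed (use fin in auto)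
    then obtain g where g: "inj_on g (I - J)" "\<forall>i\<in>I - J. g i \<in> ?B i" by (elim exE conjE)
    let ?h = "\<lambda>i. if i \<in> J then f i else g i"
    have "inj_on ?h I"
    proof (rule inj_onI)
      fix i k assume *: "i \<in> I" "k \<in> I" "?h i = ?h k"
      \<comment> \<open>The values of \<open>f\<close> lie in \<open>?U\<close> and those of
        \<open>g\<close> outside it, so the two partial matchings cannot collide.\<close>
      have fg: "f a \<noteq> g b" if "a \<in> J" "b \<in> I - J" for a b
      proof -
        have "f a \<in> ?U" using f(2) that(1) by auto
        moreover have "g b \<notin> ?U" using bspec[OF g(2) that(2)] by simp
        ultimately show ?thesis by metis
      qed
      consider "i \<in> J" "k \<in> J" | "i \<in> J" "k \<notin> J" | "i \<notin> J" "k \<in> J" | "i \<notin> J" "k \<notin> J" by blast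
      then show "i = k"
      proof cases
        case 1
        then have "f i = f k" using *(3) by simp
        then show ?thesis by (rule inj_onD[OF f(1) _ 1])
      next
        case 2
        then have "f i = g k" using *(3) by simp
        with fg[of i k] *(2) 2 show ?thesis by simp
      next
        case 3
        then have "f k = g i" using *(3) by simp
        with fg[of k i] *(1) 3 show ?thesis by simp
      next
        case 4
        then have "g i = g k" using *(3) by simp
        then show ?thesis by (rule inj_onD[OF g(1)]) (use * 4 in simp_all)
      qed
    qed
    moreover have "\<forall>i\<in>I. ?h i \<in> A i" using f g by auto
    ultimately show ?thesis by blast
  next
    case False
    show ?thesis
    proof (cases "I = {}")
      case False
      then obtain i where i: "i \<in> I" by blast
      have "card {i} \<le> card (\<Union> (A ` {i}))" using i by (intro hall) auto
      then obtain a where a: "a \<in> A i" by (cases "A i = {}") auto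
      let ?B = "\<lambda>k. A k - {a}"
      have "\<exists>f. inj_on f (I - {i}) \<and> (\<forall>k\<in>I - {i}. f k \<in> ?B k)"
      proof (rule less.hyps)
        show "card (I - {i}) < card I" using i fin(1) by (intro psubset_card_mono) auto
        show "card K \<le> card (\<Union> (?B ` K))" if K: "K \<subseteq> I - {i}" for K
        proof (cases "K = {}")
          case False
          have "card K \<le> card (\<Union> (A ` K))" using K by (intro hall) auto
          \<comment> \<open>\<open>K\<close> is nonempty and misses \<open>i\<close>, so it is not
            tight. Its union therefore has a surplus of at least one, which pays for the removal of
            \<open>a\<close>.\<close>
          moreover have "card (\<Union> (A ` K)) \<noteq> card K"
            using \<open>\<not> (\<exists>J. J \<noteq> {} \<and> J \<subset> I \<and> card (\<Union> (A ` J)) = card J)\<close> False K i by blast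
          ultimately have "card K \<le> card (\<Union> (A ` K)) - 1" by simp
          also have "\<dots> \<le> card (\<Union> (A ` K) - {a})" by (simp add: card_Diff_singleton_if)
          also have "\<Union> (A ` K) - {a} = \<Union> (?B ` K)" by auto
          finally show ?thesis .
        qed auto
      qed (use fin in auto)
      then obtain f where f: "inj_on f (I - {i})" "\<forall>k\<in>I - {i}. f k \<in> ?B k" by (elim exE conjE)
      have "inj_on (f(i := a)) I"
      proof (rule inj_onI)
        fix j k assume "j \<in> I" "k \<in> I" "(f(i := a)) j = (f(i := a)) k"
        with f show "j = k" by (cases "j = i"; cases "k = i") (auto dest: inj_onD)
      qed
      moreover have "\<forall>k\<in>I. (f(i := a)) k \<in> A k" using a f by auto
      ultimately show ?thesis by blast
    qed auto
  qed
qed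

section \<open>Counting neighbours in a regular graph\<close>

definition neighbours :: "('v, 'e) multigraph \<Rightarrow> 'v set \<Rightarrow> 'v set" where
  "neighbours G X = {y. \<exists>x\<in>X. \<exists>e\<in>edges G. ends G e = {x, y}}"

lemma graph_edgeE:
  assumes "graph G" "e \<in> edges G" "x \<in> ends G e"
  obtains y where "ends G e = {x, y}" "x \<noteq> y" "x \<in> verts G" "y \<in> verts G"
proof -
  have "card (ends G e) = 2" "ends G e \<subseteq> verts G" using assms by (auto simp: graph_def)
  then obtain a b where "ends G e = {a, b}" "a \<noteq> b" by (auto simp: card_2_iff)
  with assms(3) \<open>ends G e \<subseteq> verts G\<close>
  have "\<exists>y. ends G e = {x, y} \<and> x \<noteq> y \<and> x \<in> verts G \<and> y \<in> verts G" by auto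
  with that show ?thesis by blast
qed

lemma neighbours_subset: "graph G \<Longrightarrow> neighbours G X \<subseteq> verts G"
  by (auto simp: neighbours_def graph_def)

lemma graph_edge_neq: "graph G \<Longrightarrow> e \<in> edges G \<Longrightarrow> ends G e = {x, y} \<Longrightarrow> x \<noteq> y"
  by (auto simp: graph_def)

context
  fixes G :: "('v, 'e) multigraph" and r :: nat
  assumes G: "graph G" "regular r G" "r > 0"
begin

text \<open>These are the half-edges at \<open>X\<close>. Counting half-edges instead of adjacent
  pairs gives parallel edges their multiplicity, so each vertex contributes exactly
  \<open>r\<close>.\<close>

definition incidences :: "'v set \<Rightarrow> ('v \<times> 'e) set" where
  "incidences X = (SIGMA x:X. {e \<in> edges G. x \<in> ends G e})"

text \<open>Reversal of a half-edge: the edge is kept and its other end is taken. Since there are no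
  loops, exactly one end remains for \<open>the_elem\<close>.\<close>

definition flip :: "'v \<times> 'e \<Rightarrow> 'v \<times> 'e" where
  "flip p = (the_elem (ends G (snd p) - {fst p}), snd p)"

lemma flip_eq:
  assumes "e \<in> edges G" "ends G e = {x, y}"
  shows "flip (x, e) = (y, e)"
proof -
  have "ends G e - {x} = {y}" using assms graph_edge_neq[OF G(1) assms] by auto
  then show ?thesis by (simp add: flip_def)
qed

lemma finite_incidences: "X \<subseteq> verts G \<Longrightarrow> finite (incidences X)"
  using G(1) by (auto simp: incidences_def graph_def intro!: finite_SigmaI intro: finite_subset)

lemma card_incidences:
  assumes "X \<subseteq> verts G"
  shows "card (incidences X) = r * card X"
proof -
  have "finite X" "finite (edges G)" using assms G(1) by (auto simp: graph_def intro: finite_subset)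
  then have "card (incidences X) = (\<Sum>x\<in>X. degree G x)"
    by (simp add: incidences_def degree_def card_SigmaI)
  also have "\<dots> = (\<Sum>x\<in>X. r)"
    using assms G(2) by (intro sum.cong) (auto simp: regular_def)
  finally show ?thesis by simp
qed

lemma flip_incidences:
  assumes "X \<subseteq> verts G"
  shows "inj_on flip (incidences X)" "flip ` incidences X \<subseteq> incidences (neighbours G X)"
proof -
  show "inj_on flip (incidences X)"
  proof (rule inj_onI, safe)
    fix x e x' e'
    assume *: "(x, e) \<in> incidences X" "(x', e') \<in> incidences X" "flip (x, e) = flip (x', e')"
    then have e: "e \<in> edges G" "x \<in> ends G e" "e' = e" "x' \<in> ends G e"
      by (auto simp: incidences_def flip_def)
    show "e = e'" using e(3) ..
    obtain y where y: "ends G e = {x, y}" "x \<noteq> y" using graph_edgeE[OF G(1) e(1,2)] by metis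
    obtain y' where y': "ends G e = {x', y'}" "x' \<noteq> y'" using graph_edgeE[OF G(1) e(1,4)] by metis
    show "x = x'"
      using * flip_eq[OF e(1) y(1)] flip_eq[OF e(1) y'(1)] e(3) y y' by (auto simp: doubleton_eq_iff)
  qed
  show "flip ` incidences X \<subseteq> incidences (neighbours G X)"
  proof (rule image_subsetI)
    fix p assume "p \<in> incidences X"
    then obtain x e where p: "p = (x, e)" and e: "x \<in> X" "e \<in> edges G" "x \<in> ends G e"
      by (auto simp: incidences_def)
    obtain y where y: "ends G e = {x, y}" using graph_edgeE[OF G(1) e(2,3)] by metis
    then show "flip p \<in> incidences (neighbours G X)"
      unfolding p using flip_eq[OF e(2) y] e by (auto simp: incidences_def neighbours_def)
  qed
qed

text \<open>Reversal injects the \<open>r * card X\<close> half-edges at \<open>X\<close> into the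
  \<open>r * card (neighbours G X)\<close> half-edges at the neighbours; then cancel
  \<open>r\<close>.\<close>

lemma card_le_card_neighbours:
  assumes "X \<subseteq> verts G"
  shows "card X \<le> card (neighbours G X)"
proof -
  have N: "neighbours G X \<subseteq> verts G" by (rule neighbours_subset[OF G(1)])
  have "card (incidences X) \<le> card (incidences (neighbours G X))"
    using flip_incidences[OF assms] finite_incidences[OF N] by (intro card_inj_on_le)
  then show ?thesis using card_incidences assms N G(3) by simp
qed

text \<open>In the case of equality the injection \<open>flip\<close> is onto, so every half-edge at
  a neighbour of \<open>X\<close> is the reversal of one at \<open>X\<close>. Hence no edge leaves
  \<open>neighbours G X\<close> except into \<open>X\<close>.\<close>

lemma neighbours_neighbours_subset:
  assumes "X \<subseteq> verts G" and "card (neighbours G X) = card X"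
  shows "neighbours G (neighbours G X) \<subseteq> X"
proof
  fix z assume "z \<in> neighbours G (neighbours G X)"
  then obtain y e where y: "y \<in> neighbours G X" "e \<in> edges G" "ends G e = {y, z}"
    by (auto simp: neighbours_def)
  have N: "neighbours G X \<subseteq> verts G" by (rule neighbours_subset[OF G(1)])
  have "card (flip ` incidences X) = card (incidences (neighbours G X))"
    using flip_incidences(1)[OF assms(1)] card_incidences assms N by (simp add: card_image)
  then have "flip ` incidences X = incidences (neighbours G X)"
    using flip_incidences(2)[OF assms(1)] finite_incidences[OF N] by (intro card_subset_eq)
  moreover have "(y, e) \<in> incidences (neighbours G X)" using y by (auto simp: incidences_def)
  ultimately obtain p where p: "p \<in> incidences X" "flip p = (y, e)" by (metis imageE)
  define x where "x = fst p"
  have "p = (x, e)" using p(2) by (simp add: x_def flip_def prod_eq_iff)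
  with p have x: "(x, e) \<in> incidences X" "flip (x, e) = (y, e)" by simp_all
  then have "x \<in> X" "x \<in> ends G e" by (auto simp: incidences_def)
  \<comment> \<open>The edge \<open>e\<close> has the ends \<open>y\<close> and \<open>z\<close>, so
    an end \<open>x\<close> in \<open>X\<close> other than \<open>y\<close> must be \<open>z\<close>
    itself.\<close>
  moreover have "x \<noteq> y"
  proof
    assume "x = y"
    with x(2) flip_eq[OF y(2,3)] have "z = y" by simp
    with graph_edge_neq[OF G(1) y(2,3)] show False by simp
  qed
  ultimately show "z \<in> X" using y(3) by auto
qed

end

section \<open>Walks, connectedness and components\<close>

lemma walk_closed:
  assumes "walk G xs es" and "\<And>e x y. e \<in> edges G \<Longrightarrow> ends G e = {x, y} \<Longrightarrow> P x \<Longrightarrow> P y"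
  shows "P (hd xs) \<Longrightarrow> P (last xs)"
  using assms(1) by induction (use assms(2) in auto)

text \<open>The induction principle for connected graphs, used below both for vertex sets closed
  under adjacency and for the degree in the factor. Since \<open>ends\<close> is unordered, the
  closure hypothesis covers both directions of an edge.\<close>

lemma connected_graph_closed:
  assumes "connected_graph G" and "\<And>e x y. e \<in> edges G \<Longrightarrow> ends G e = {x, y} \<Longrightarrow> P x \<Longrightarrow> P y"
    and "x \<in> verts G" "P x" "y \<in> verts G"
  shows "P y"
proof -
  obtain xs es where "walk G xs es" "hd xs = x" "last xs = y"
    using assms(1,3,5) unfolding connected_graph_def path_between_def by blast
  then show ?thesis using walk_closed[of G xs es P] assms(2,4) by blast
qed

lemma walk_neq_Nil: "walk G xs es \<Longrightarrow> xs \<noteq> []"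
  by (induction rule: walk.induct) auto

lemma walk_set: "walk G xs es \<Longrightarrow> set xs \<subseteq> verts G"
  by (induction rule: walk.induct) auto

lemma walk_subgraph:
  assumes "walk H xs es" "subgraph H G"
  shows "walk G xs es"
  using assms(1)
  by induction (use assms(2) in \<open>auto simp: subgraph_def intro!: walk.intros\<close>)

lemma walk_snoc:
  assumes "walk G xs es" "e \<in> edges G" "ends G e = {last xs, y}" "y \<in> verts G"
  shows "walk G (xs @ [y]) (es @ [e])"
  using assms by induction (auto intro: walk.intros)

text \<open>If \<open>y\<close> is new, a path of \<open>C\<close> ending or starting at
  \<open>x\<close> is extended by \<open>e\<close>; it stays a path because \<open>y\<close> lies
  outside \<open>C\<close>. If \<open>y\<close> is already in \<open>C\<close>, the paths of
  \<open>C\<close> suffice.\<close>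

lemma connected_graph_add_edge:
  assumes C: "subgraph C D" "connected_graph C"
    and e: "e \<in> edges D" "ends D e = {x, y}" and x: "x \<in> verts C" and D: "verts D = insert y (verts C)"
  shows "connected_graph D"
  unfolding connected_graph_def
proof (intro conjI ballI)
  show "verts D \<noteq> {}" using D by simp
  have inC: "\<exists>xs es. path_between D a xs es b" if "a \<in> verts C" "b \<in> verts C" for a b
    using that C walk_subgraph[OF _ C(1)] by (fastforce simp: connected_graph_def path_between_def)
  fix a b assume ab: "a \<in> verts D" "b \<in> verts D"
  consider "a \<in> verts C" "b \<in> verts C" | "a = b" "a \<notin> verts C"
    | "a \<in> verts C" "b \<notin> verts C" "b = y" | "a \<notin> verts C" "a = y" "b \<in> verts C"
    using ab D by auto
  then show "\<exists>xs es. path_between D a xs es b"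
  proof cases
    case 1
    then show ?thesis by (rule inC)
  next
    case 2
    then have "path_between D a [a] [] b"
      using ab by (auto simp: path_between_def intro: walk.intros)
    then show ?thesis by blast
  next
    case 3
    obtain xs es where p: "walk C xs es" "distinct xs" "hd xs = a" "last xs = x"
      using C(2) 3 x unfolding connected_graph_def path_between_def by blast
    have "walk D (xs @ [y]) (es @ [e])"
      using walk_subgraph[OF p(1) C(1)] p(4) e D by (intro walk_snoc) auto
    moreover have "distinct (xs @ [y])" using p walk_set[OF p(1)] 3 by auto
    ultimately have "path_between D a (xs @ [y]) (es @ [e]) b"
      using p 3 walk_neq_Nil[OF p(1)] by (simp add: path_between_def)
    then show ?thesis by blast
  next
    case 4
    obtain xs es where p: "walk C xs es" "distinct xs" "hd xs = x" "last xs = b"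
      using C(2) 4 x unfolding connected_graph_def path_between_def by blast
    obtain zs where zs: "xs = x # zs" using p(3) walk_neq_Nil[OF p(1)] by (cases xs) auto
    have "walk D (y # xs) (e # es)"
      using walk_subgraph[OF p(1) C(1)] e D unfolding zs
      by (intro walk_step) (auto simp: insert_commute)
    moreover have "distinct (y # xs)" using p walk_set[OF p(1)] 4 by auto
    ultimately have "path_between D a (y # xs) (e # es) b"
      using p 4 walk_neq_Nil[OF p(1)] by (simp add: path_between_def)
    then show ?thesis by blast
  qed
qed

text \<open>By maximality of a component: adding \<open>e\<close> and its other end to
  \<open>C\<close> yields a connected subgraph \<open>D\<close> of \<open>F\<close> that contains
  \<open>C\<close>, so \<open>D = C\<close>. Consequently degrees in a component agree with degrees
  in the whole graph.\<close>

lemma component_edge: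
  assumes F: "graph F" and C: "component C F" and x: "x \<in> verts C"
    and e: "e \<in> edges F" "x \<in> ends F e"
  shows "e \<in> edges C"
proof -
  obtain y where y: "ends F e = {x, y}" "y \<in> verts F" using graph_edgeE[OF F e] by metis
  have sub: "subgraph C F" "connected_graph C" using C by (auto simp: component_def)
  define D where "D = \<lparr>verts = insert y (verts C), edges = insert e (edges C), ends = ends F\<rparr>"
  have Cfin: "finite (verts C)" "finite (edges C)" and CF: "edges C \<subseteq> edges F"
    using sub(1) by (auto simp: subgraph_def graph_def)
  have ends_C: "ends F f \<subseteq> verts C" if "f \<in> edges C" for f
    using sub(1) that unfolding subgraph_def graph_def by metis
  from CF have "card (ends F f) = 2" if "f \<in> edges D" for f
    using F e(1) that by (auto simp: D_def graph_def)
  moreover have "ends F f \<subseteq> insert y (verts C)" if "f \<in> edges D" for f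
    using ends_C[of f] x y(1) that by (auto simp: D_def)
  ultimately have "graph D"
    using Cfin by (simp add: graph_def D_def)
  then have D: "subgraph D F" "subgraph C D"
    using sub e y by (auto simp: subgraph_def D_def)
  have "connected_graph D"
    using D(2) sub(2) by (rule connected_graph_add_edge[where e = e and x = x and y = y])
      (use y x in \<open>auto simp: D_def\<close>)
  with D C have "D = C" by (auto simp: component_def)
  then have "edges C = insert e (edges C)" by (metis D_def multigraph.select_convs(2))
  then show ?thesis by blast
qed

lemma degree_component:
  assumes "graph F" "component C F" "x \<in> verts C"
  shows "degree C x = degree F x"
proof -
  have "{e \<in> edges C. x \<in> ends C e} = {e \<in> edges F. x \<in> ends F e}"
    using component_edge[OF assms] assms(2) by (auto simp: component_def subgraph_def)
  then show ?thesis by (simp add: degree_def)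
qed

section \<open>From a permutation along edges to a good factor\<close>

text \<open>Each vertex meets the edge to its image and the edge from its preimage. These coincide
  exactly on 2-cycles of \<open>\<sigma>\<close>, so the degree is 1 there and 2 elsewhere. It is
  constant along edges of \<open>F\<close>, hence on each component, which makes the components
  regular.\<close>

lemma good_one_two_factor_of_permutation:
  assumes H: "graph H" and \<sigma>: "bij_betw \<sigma> (verts H) (verts H)"
    and adj: "\<And>x. x \<in> verts H \<Longrightarrow> \<exists>e\<in>edges H. ends H e = {x, \<sigma> x}"
  shows "\<exists>F. good_one_two_factor F H"
proof -
  \<comment> \<open>The edge depends on the unordered pair only, so that a 2-cycle of \<open>\<sigma>\<close> yields a single edge.\<close>
  define \<epsilon> where "\<epsilon> p = (SOME e. e \<in> edges H \<and> ends H e = p)" for p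
  define F where "F = \<lparr>verts = verts H, edges = (\<lambda>x. \<epsilon> {x, \<sigma> x}) ` verts H, ends = ends H\<rparr>"
  have \<epsilon>: "\<epsilon> {x, \<sigma> x} \<in> edges H" "ends H (\<epsilon> {x, \<sigma> x}) = {x, \<sigma> x}" if "x \<in> verts H" for x
  proof -
    have "\<exists>e. e \<in> edges H \<and> ends H e = {x, \<sigma> x}" using adj[OF that] by blast
    then show "\<epsilon> {x, \<sigma> x} \<in> edges H" "ends H (\<epsilon> {x, \<sigma> x}) = {x, \<sigma> x}"
      unfolding \<epsilon>_def by (metis (mono_tags, lifting) someI_ex)+
  qed
  have neq: "x \<noteq> \<sigma> x" if "x \<in> verts H" for x
    using graph_edge_neq[OF H \<epsilon>[OF that]] .
  have in_H: "\<sigma> x \<in> verts H" if "x \<in> verts H" for x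
    using \<sigma> that by (auto simp: bij_betw_def)
  have inj: "\<sigma> x = \<sigma> y \<longleftrightarrow> x = y" if "x \<in> verts H" "y \<in> verts H" for x y
    using \<sigma> that by (auto simp: bij_betw_def inj_on_def)
  have "graph F"
    using H \<epsilon> in_H neq by (auto simp: graph_def F_def)
  then have FH: "spanning_subgraph F H"
    using \<epsilon> by (auto simp: spanning_subgraph_def subgraph_def F_def)
  have deg: "degree F x = (if \<sigma> (\<sigma> x) = x then 1 else 2)" if x: "x \<in> verts H" for x
  proof -
    \<comment> \<open>\<open>w\<close> is the preimage of \<open>x\<close> under
      \<open>\<sigma>\<close>; an edge of \<open>F\<close> at \<open>x\<close> was chosen either for
      \<open>x\<close> or for \<open>w\<close>.\<close>
    obtain w where w: "w \<in> verts H" "\<sigma> w = x"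
      using \<sigma> x unfolding bij_betw_def by (metis imageE)
    have eq: "{e \<in> edges F. x \<in> ends F e} = {\<epsilon> {x, \<sigma> x}, \<epsilon> {w, x}}"
    proof (intro set_eqI iffI)
      fix e assume "e \<in> {e \<in> edges F. x \<in> ends F e}"
      then obtain z where z: "z \<in> verts H" "e = \<epsilon> {z, \<sigma> z}" "x \<in> {z, \<sigma> z}"
        using \<epsilon>(2) by (auto simp: F_def)
      then show "e \<in> {\<epsilon> {x, \<sigma> x}, \<epsilon> {w, x}}" using w inj[of z w] by auto
    next
      fix e assume "e \<in> {\<epsilon> {x, \<sigma> x}, \<epsilon> {w, x}}"
      then show "e \<in> {e \<in> edges F. x \<in> ends F e}"
        using \<epsilon>(2)[OF x] \<epsilon>(2)[OF w(1)] x w by (auto simp: F_def)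
    qed
    have "\<epsilon> {x, \<sigma> x} = \<epsilon> {w, x} \<longleftrightarrow> \<sigma> (\<sigma> x) = x"
    proof
      assume "\<epsilon> {x, \<sigma> x} = \<epsilon> {w, x}"
      then have "{x, \<sigma> x} = {w, x}" using \<epsilon>(2)[OF x] \<epsilon>(2)[OF w(1)] w(2) by metis
      then show "\<sigma> (\<sigma> x) = x" using neq[OF w(1)] w(2) by (auto simp: doubleton_eq_iff)
    next
      assume "\<sigma> (\<sigma> x) = x"
      then have "\<sigma> x = w" using w inj[of "\<sigma> x" w] in_H[OF x] by simp
      then show "\<epsilon> {x, \<sigma> x} = \<epsilon> {w, x}" by (simp add: insert_commute)
    qed
    then show ?thesis unfolding degree_def eq by auto
  qed
  have step: "degree F y = degree F x" if xy: "e \<in> edges F" "ends F e = {x, y}" for e x y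
  proof -
    obtain z where z: "z \<in> verts H" "{x, y} = {z, \<sigma> z}"
      using xy \<epsilon>(2) by (auto simp: F_def)
    \<comment> \<open>By injectivity \<open>\<sigma>\<close> fixes
      \<open>\<sigma> (\<sigma> z)\<close> to \<open>\<sigma> z\<close> under two applications
      exactly when it does so for \<open>z\<close>: lying on a 2-cycle is invariant under
      \<open>\<sigma>\<close>.\<close>
    have "degree F (\<sigma> z) = degree F z"
      using z(1) deg in_H inj by simp
    with z(2) show ?thesis by (auto simp: doubleton_eq_iff)
  qed
  have "\<exists>k. regular k C" if C: "component C F" for C
  proof -
    have sub: "subgraph C F" "connected_graph C" using C by (auto simp: component_def)
    obtain x where x: "x \<in> verts C" using sub(2) by (auto simp: connected_graph_def)
    have "degree C y = degree F x" if "y \<in> verts C" for y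
    proof -
      have "degree F y = degree F x"
        by (rule connected_graph_closed[OF sub(2) _ x refl that])
          (use step sub(1) in \<open>auto simp: subgraph_def\<close>)
      then show ?thesis using degree_component[OF \<open>graph F\<close> C that] by simp
    qed
    then show ?thesis by (auto simp: regular_def)
  qed
  then have "good_one_two_factor F H"
    using FH deg by (auto simp: good_one_two_factor_def one_two_factor_def)
  then show ?thesis by blast
qed

section \<open>The permutation of the vertices other than \<open>v\<close>\<close>

text \<open>Excluding \<open>v\<close> costs a set at most one neighbour, so Hall's condition can
  fail only for an \<open>X\<close> with exactly \<open>card X\<close> neighbours, \<open>v\<close>
  among them. Then every edge at \<open>X\<close> leads to \<open>neighbours G X\<close> and every
  edge at \<open>neighbours G X\<close> leads back, and the two sets turn out to be a bipartition of
  \<open>G\<close>.\<close>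

lemma deleted_vertex_permutation:
  fixes G :: "('v, 'e) multigraph"
  assumes G: "graph G" "regular r G" "r > 0" and nb: "\<not> bipartite G"
    and con: "connected_graph G" and v: "v \<in> verts G"
  shows "\<exists>\<sigma>. bij_betw \<sigma> (verts G - {v}) (verts G - {v}) \<and>
    (\<forall>x\<in>verts G - {v}. \<exists>e\<in>edges G. ends G e = {x, \<sigma> x})"
proof -
  let ?W = "verts G - {v}"
  have fin: "finite (verts G)" using G(1) by (simp add: graph_def)
  have "\<exists>f. inj_on f ?W \<and> (\<forall>x\<in>?W. f x \<in> neighbours G {x} - {v})"
  proof (rule hall_marriage)
    show "finite ?W" using fin by simp
    show "finite (neighbours G {x} - {v})" for x
      using fin neighbours_subset[OF G(1)] by (auto intro: finite_subset)
    fix X assume X: "X \<subseteq> ?W"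
    let ?N = "neighbours G X"
    have XG: "X \<subseteq> verts G" using X by blast
    have eq: "(\<Union>x\<in>X. neighbours G {x} - {v}) = ?N - {v}" by (auto simp: neighbours_def)
    have "card X \<le> card (?N - {v})"
    proof (rule ccontr)
      assume less: "\<not> card X \<le> card (?N - {v})"
      have le: "card X \<le> card ?N" by (rule card_le_card_neighbours[OF G XG])
      have "v \<in> ?N" using less le by (cases "v \<in> ?N") auto
      then have "card ?N = card X" using less le by simp
      then have NN: "neighbours G ?N \<subseteq> X" by (rule neighbours_neighbours_subset[OF G XG])
      have NG: "?N \<subseteq> verts G" by (rule neighbours_subset[OF G(1)])
      have adjX: "y \<in> ?N" if "e \<in> edges G" "ends G e = {x, y}" "x \<in> X" for e x y
        using that by (auto simp: neighbours_def)
      have adjN: "y \<in> X" if "e \<in> edges G" "ends G e = {x, y}" "x \<in> ?N" for e x y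
        using that NN unfolding neighbours_def[of G ?N] by blast
      \<comment> \<open>Adjacency exchanges \<open>X\<close> and \<open>?N\<close>, so their union
        is closed under it and, containing \<open>v\<close>, is everything.\<close>
      have all: "y \<in> X \<union> ?N" if "y \<in> verts G" for y
        by (rule connected_graph_closed[OF con, where x = v])
          (use adjX adjN v \<open>v \<in> ?N\<close> that in auto)
      have "X \<inter> ?N = {}"
      proof (rule ccontr)
        assume "X \<inter> ?N \<noteq> {}"
        then obtain x where x: "x \<in> X \<inter> ?N" by blast
        \<comment> \<open>The intersection is closed under adjacency too. If nonempty it would reach
          \<open>v\<close>, but \<open>X\<close> avoids \<open>v\<close>.\<close>
        have "v \<in> X \<inter> ?N"
          by (rule connected_graph_closed[OF con, where x = x])
            (use adjX adjN v XG x in auto)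
        with X show False by blast
      qed
      moreover have "\<exists>a\<in>X. \<exists>b\<in>?N. ends G e = {a, b}" if e: "e \<in> edges G" for e
      proof -
        obtain x y where xy: "ends G e = {x, y}" "x \<in> verts G"
          using G(1) e by (auto simp: graph_def card_2_iff)
        show ?thesis
        proof (cases "x \<in> X")
          case True
          then show ?thesis using xy(1) adjX[OF e xy(1)] by blast
        next
          case False
          then have "x \<in> ?N" using all[OF xy(2)] by blast
          then show ?thesis using xy(1) adjN[OF e xy(1)] by (metis insert_commute)
        qed
      qed
      ultimately have "bipartite G"
        unfolding bipartite_def using all XG NG by (intro exI[of _ X] exI[of _ ?N]) auto
      with nb show False ..
    qed
    then show "card X \<le> card (\<Union>x\<in>X. neighbours G {x} - {v})" unfolding eq .
  qed
  then obtain f where f: "inj_on f ?W" "\<forall>x\<in>?W. f x \<in> neighbours G {x} - {v}" by blast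
  have "f ` ?W \<subseteq> ?W" using f(2) neighbours_subset[OF G(1)] by blast
  then have "bij_betw f ?W ?W"
    using f(1) fin by (simp add: bij_betw_def endo_inj_surj)
  moreover have "\<forall>x\<in>?W. \<exists>e\<in>edges G. ends G e = {x, f x}" using f(2) by (auto simp: neighbours_def)
  ultimately show ?thesis by blast
qed

section \<open>The one-vertex tree and the conclusion\<close>

text \<open>The only vertex has degree 0, so there is no leaf and the parity condition is vacuous; a
  cycle would need an edge.\<close>

lemma even_tree_single_vertex: "even_tree \<lparr>verts = {v}, edges = {}, ends = f\<rparr>"
proof -
  let ?T = "\<lparr>verts = {v}, edges = {}, ends = f\<rparr>"
  have "path_between ?T v [v] [] v" by (auto simp: path_between_def intro: walk.intros)
  then have "connected_graph ?T" by (auto simp: connected_graph_def)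
  moreover have "\<not> cycle ?T xs es" for xs es
    by (auto simp: cycle_def elim: walk.cases)
  ultimately show ?thesis by (auto simp: even_tree_def tree_def graph_def degree_def)
qed

theorem theorem3:
  fixes G :: "('v, 'e) multigraph" and r :: nat
  assumes "odd r" and "r > 0"
    and "graph G" and "regular r G" and "\<not> bipartite G" and "connected_graph G"
  shows "\<exists>T. good_even_tree T G"
proof -
  obtain v where v: "v \<in> verts G" using assms(6) by (auto simp: connected_graph_def)
  let ?T = "\<lparr>verts = {v}, edges = {}, ends = ends G\<rparr>" and ?H = "delete_verts G {v}"
  obtain \<sigma> where \<sigma>: "bij_betw \<sigma> (verts G - {v}) (verts G - {v})"
      "\<forall>x\<in>verts G - {v}. \<exists>e\<in>edges G. ends G e = {x, \<sigma> x}"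
    using deleted_vertex_permutation[OF assms(3,4,2,5,6) v] by blast
  have "\<exists>F. good_one_two_factor F ?H"
  proof (rule good_one_two_factor_of_permutation)
    show "graph ?H" using assms(3) by (auto simp: graph_def delete_verts_def)
    show "bij_betw \<sigma> (verts ?H) (verts ?H)" using \<sigma>(1) by (simp add: delete_verts_def)
    fix x assume "x \<in> verts ?H"
    then have x: "x \<in> verts G - {v}" by (simp add: delete_verts_def)
    \<comment> \<open>Both \<open>x\<close> and \<open>\<sigma> x\<close> differ from
      \<open>v\<close>, so the edge of \<open>G\<close> joining them survives the deletion.\<close>
    then have "\<sigma> x \<in> verts G - {v}" using \<sigma>(1) by (auto simp: bij_betw_def)
    moreover obtain e where "e \<in> edges G" "ends G e = {x, \<sigma> x}" using \<sigma>(2) x by blast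
    ultimately show "\<exists>e\<in>edges ?H. ends ?H e = {x, \<sigma> x}"
      using x by (intro bexI[of _ e]) (auto simp: delete_verts_def)
  qed
  moreover have "subgraph ?T G" using v by (simp add: subgraph_def graph_def)
  ultimately have "good_even_tree ?T G"
    using even_tree_single_vertex by (simp add: good_even_tree_def)
  then show ?thesis by blast
qed

end
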